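(* Let $M,N$ be weights of $\mathbb{R}^m,\mathbb{R}^n$, let $A\in\mathbb{R}^{m\times n}$ with $MA=AN$, and let $K\subseteq\mathbb{R}^n$ be a closed cone with $A^{[\dagger]}\circ A\circ K\subseteq K$. Then the cone $(A\circ I\circ K)^{[*]}\cap\mathcal{R}(A\circ I)$ is acute if and only if $$(A\circ I\circ K)^{[*]}\cap\mathcal{R}(A\circ I)\subseteq A\circ I\circ K.$$
   Context: A weight is a real symmetric matrix $W$ with $W^2=I$. $\mathbb{R}^m$ and $\mathbb{R}^n$ carry weights $M\in\mathbb{R}^{m\times m}$ and $N\in\mathbb{R}^{n\times n}$, respectively. The indefinite inner product on the space with weight $W$ is $[x,y]=\langle x,Wy\rangle$. Indefinite matrix product: if $B$ has $p$ columns and $C$ has $p$ rows (or is a vector in $\mathbb{R}^p$), $p\in\{m,n\}$, and $W$ is the weight of $\mathbb{R}^p$, then $B\circ C:=BWC$. $I$ denotes an identity matrix of the appropriate size. Indefinite adjoint of $B\in\mathbb{R}^{p\times q}$: $B^{[*]}:=W_qB^TW_p$, where $W_p,W_q$ are the weights of $\mathbb{R}^p,\mathbb{R}^q$. Indefinite Moore–Penrose inverse: $A^{[\dagger]}$ is the unique $X\in\mathbb{R}^{n\times m}$ such that - $A\circ X\circ A=A$, - $X\circ A\circ X=X$, - $(A\circ X)^{[*]}=A\circ X$, - $(X\circ A)^{[*]}=X\circ A$. It equals $NA^\dagger M$. Range and null space: for a matrix $B$ with $q$ columns, $\mathcal{R}(B)=\{B\circ x:x\in\mathbb{R}^q\}$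 and $\mathcal{N}(B)=\{x\in\mathbb{R}^q:B\circ x=0\}$. A cone is a nonempty set closed under addition and under multiplication by nonnegative scalars. For $S$ a subset of $\mathbb{R}^p$ with weight $W$, the dual is $S^{[*]}=\{x\in\mathbb{R}^p:[x,t]\ge0\ \forall t\in S\}$. For a matrix $B$ and a set $S$, $B\circ S=\{B\circ s:s\in S\}$. A cone $C$ is acute if $[x,y]\ge0$ for all $x,y\in C$, equivalently $C\subseteq C^{[*]}$. *)

theory Defs
  imports "HOL-Analysis.Analysis"
begin

text \<open>Matrices are \<open>real^'q^'p\<close> (p rows, q columns). A weight is a real symmetric
  involutory matrix.\<close>

definition weight :: "real^'p^'p \<Rightarrow> bool" where
  "weight W \<longleftrightarrow> transpose W = W \<and> W ** W = mat 1"

text \<open>Indefinite inner product on the space with weight W.\<close>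
definition iinner :: "real^'p^'p \<Rightarrow> real^'p \<Rightarrow> real^'p \<Rightarrow> real" where
  "iinner W x y = x \<bullet> (W *v y)"

text \<open>Indefinite products B \<circ> C = B W C, W the weight of the middle space.\<close>
definition imult :: "real^'q^'q \<Rightarrow> real^'q^'p \<Rightarrow> real^'r^'q \<Rightarrow> real^'r^'p" where
  "imult W B C = B ** W ** C"

definition imultv :: "real^'q^'q \<Rightarrow> real^'q^'p \<Rightarrow> real^'q \<Rightarrow> real^'p" where
  "imultv W B x = B *v (W *v x)"

definition imultset :: "real^'q^'q \<Rightarrow> real^'q^'p \<Rightarrow> (real^'q) set \<Rightarrow> (real^'p) set" where
  "imultset W B S = imultv W B ` S"

text \<open>Indefinite adjoint of B in R^(p x q): Wq B^T Wp.\<close>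
definition iadj :: "real^'p^'p \<Rightarrow> real^'q^'q \<Rightarrow> real^'q^'p \<Rightarrow> real^'p^'q" where
  "iadj Wp Wq B = Wq ** transpose B ** Wp"

text \<open>Indefinite Moore--Penrose inverse of A in R^(m x n), weights M of R^m, N of R^n.\<close>
definition impinv :: "real^'m^'m \<Rightarrow> real^'n^'n \<Rightarrow> real^'n^'m \<Rightarrow> real^'m^'n" where
  "impinv M N A = (THE X.
      imult M (imult N A X) A = A \<and>
      imult N (imult M X A) X = X \<and>
      iadj M M (imult N A X) = imult N A X \<and>
      iadj N N (imult M X A) = imult M X A)"

text \<open>Range of a matrix B with q columns (weight Wq of R^q).\<close>
definition irange :: "real^'q^'q \<Rightarrow> real^'q^'p \<Rightarrow> (real^'p) set" where
  "irange Wq B = {imultv Wq B x | x. True}"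

definition icone :: "('a::real_vector) set \<Rightarrow> bool" where
  "icone C \<longleftrightarrow> C \<noteq> {} \<and> (\<forall>x\<in>C. \<forall>y\<in>C. x + y \<in> C) \<and> (\<forall>x\<in>C. \<forall>c::real. c \<ge> 0 \<longrightarrow> c *\<^sub>R x \<in> C)"

definition idual :: "real^'p^'p \<Rightarrow> (real^'p) set \<Rightarrow> (real^'p) set" where
  "idual W S = {x. \<forall>t\<in>S. iinner W x t \<ge> 0}"

definition acute :: "real^'p^'p \<Rightarrow> (real^'p) set \<Rightarrow> bool" where
  "acute W C \<longleftrightarrow> (\<forall>x\<in>C. \<forall>y\<in>C. iinner W x y \<ge> 0)"

end

theory Submission
  imports Defs
begin

text \<open>
  The indefinite Moore--Penrose inverse is \<open>N A\<^sup>\<dagger> M\<close>, where \<open>A\<^sup>\<dagger>\<close> is the ordinary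
  Moore--Penrose inverse, built from the orthogonal projections onto the row and column spaces
  of \<open>A\<close>. With \<open>MA = AN\<close> this gives \<open>A A^[\<dagger>] A = A\<close>, so the invariance of \<open>K\<close> under
  \<open>A^[\<dagger>] A\<close> exhibits the cone \<open>C = A K\<close> as \<open>R(A) \<inter> (A^[\<dagger>])\<^sup>-\<^sup>1 K\<close>, which is closed.
  If some \<open>y \<in> C^[*] \<inter> R(A)\<close> lies outside \<open>C\<close>, the nearest point \<open>c\<close> of \<open>C\<close> to \<open>y\<close> yields
  \<open>w = c - y \<in> R(A)\<close> with \<open>\<langle>w, C\<rangle> \<ge> 0\<close> and \<open>\<langle>w, y\<rangle> < 0\<close>. Since \<open>M\<close> preserves \<open>R(A)\<close> and
  \<open>[Mw, z] = \<langle>w, z\<rangle>\<close>, the vector \<open>Mw\<close> lies in \<open>C^[*] \<inter> R(A)\<close> and \<open>[y, Mw] < 0\<close>, so the cone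
  is not acute. Conversely \<open>[x, y] \<ge> 0\<close> whenever \<open>x \<in> C^[*]\<close> and \<open>y \<in> C\<close>.
\<close>

lemma weight_mult_cancel:
  assumes "weight W"
  shows "W ** (W ** B) = B" "C ** W ** W = C"
  using assms unfolding weight_def
  by (simp_all add: matrix_mul_assoc[symmetric]) (simp add: matrix_mul_assoc)

lemma weight_mult_inj:
  assumes "weight W"
  shows "W ** B = W ** C \<longleftrightarrow> B = C" "D ** W = E ** W \<longleftrightarrow> D = E"
  by (metis assms weight_mult_cancel(1)) (metis assms weight_mult_cancel(2))

lemma iinner_weight_right:
  assumes "weight W"
  shows "iinner W x (W *v y) = x \<bullet> y"
  using assms unfolding weight_def iinner_def by (simp add: matrix_vector_mul_assoc)

lemma iinner_weight_left:
  assumes "weight W"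
  shows "iinner W (W *v x) y = x \<bullet> y"
proof -
  have "W *v x = x v* W"
    using assms unfolding weight_def by (metis transpose_matrix_vector)
  then show ?thesis
    by (simp add: iinner_def dot_lmul_matrix iinner_weight_right[OF assms, unfolded iinner_def])
qed

lemma imultv_weighted_identity:
  assumes "weight W"
  shows "imultv W (imult W B (mat 1)) x = B *v x"
  using assms unfolding weight_def imultv_def imult_def
  by (simp add: matrix_vector_mul_assoc weight_mult_cancel[OF assms])

definition moore_penrose :: "real^'n^'m \<Rightarrow> real^'m^'n \<Rightarrow> bool" where
  "moore_penrose A Y \<longleftrightarrow> A ** Y ** A = A \<and> Y ** A ** Y = Y \<and>
     transpose (A ** Y) = A ** Y \<and> transpose (Y ** A) = Y ** A"

lemma orthogonal_projection_matrix_exists: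
  fixes S :: "(real^'n) set"
  assumes "subspace S"
  obtains P :: "real^'n^'n" where "transpose P = P" "\<And>x. P *v x \<in> S"
    "\<And>x. x \<in> S \<Longrightarrow> P *v x = x" "\<And>x s. s \<in> S \<Longrightarrow> (x - P *v x) \<bullet> s = 0"
proof -
  obtain B where B: "B \<subseteq> S" "pairwise orthogonal B" "span B = S"
    using orthogonal_basis_subspace[OF assms] by metis
  define P :: "real^'n^'n" where "P = (\<chi> i j. \<Sum>b\<in>B. b$i * b$j / (b \<bullet> b))"
  have Pv: "P *v x = (\<Sum>b\<in>B. (b \<bullet> x / (b \<bullet> b)) *\<^sub>R b)" for x
  proof (unfold vec_eq_iff, intro allI)
    fix i
    have "(P *v x) $ i = (\<Sum>j\<in>UNIV. \<Sum>b\<in>B. b$i * b$j / (b \<bullet> b) * x$j)"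
      by (simp add: P_def matrix_vector_mult_def sum_distrib_right)
    also have "\<dots> = (\<Sum>b\<in>B. \<Sum>j\<in>UNIV. b$i * b$j / (b \<bullet> b) * x$j)"
      by (rule sum.swap)
    also have "\<dots> = (\<Sum>b\<in>B. (b \<bullet> x / (b \<bullet> b)) * b$i)"
      by (simp add: inner_vec_def sum_distrib_left sum_divide_distrib mult_ac)
    finally show "(P *v x) $ i = (\<Sum>b\<in>B. (b \<bullet> x / (b \<bullet> b)) *\<^sub>R b) $ i"
      by simp
  qed
  have symmetric: "transpose P = P"
    unfolding P_def by (simp add: transpose_def vec_eq_iff mult.commute)
  have orthogonal: "(x - P *v x) \<bullet> s = 0" if "s \<in> S" for x s
    using Gram_Schmidt_step[OF B(2), of s x] that B(3)
    by (simp add: Pv orthogonal_def inner_commute)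
  have range: "P *v x \<in> S" for x
    unfolding Pv B(3)[symmetric] by (intro span_sum span_mul span_base)
  have fixes_S: "P *v x = x" if "x \<in> S" for x
  proof -
    have "x - P *v x \<in> S" using that range assms by (simp add: subspace_diff)
    then have "(x - P *v x) \<bullet> (x - P *v x) = 0" by (rule orthogonal)
    then show ?thesis by simp
  qed
  show thesis by (rule that[OF symmetric range fixes_S orthogonal])
qed

lemma kernel_orthogonal_range_transpose:
  fixes A :: "real^'n^'m"
  shows "A *v v = 0 \<longleftrightarrow> (\<forall>s\<in>range ((*v) (transpose A)). v \<bullet> s = 0)"
proof -
  have "v \<bullet> (transpose A *v z) = z \<bullet> (A *v v)" for z
    by (metis transpose_matrix_vector inner_commute dot_lmul_matrix)
  then show ?thesis by (metis inner_eq_zero_iff inner_zero_right rangeE rangeI)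
qed

lemma moore_penrose_exists:
  fixes A :: "real^'n^'m"
  obtains Y where "moore_penrose A Y"
proof -
  define R where "R = range ((*v) (transpose A))"
  have "subspace R" "subspace (range ((*v) A))"
    unfolding R_def by (intro linear_subspace_image matrix_vector_mul_linear subspace_UNIV)+
  obtain P where P: "transpose P = P" "\<And>x. P *v x \<in> R"
    "\<And>x. x \<in> R \<Longrightarrow> P *v x = x" "\<And>x s. s \<in> R \<Longrightarrow> (x - P *v x) \<bullet> s = 0"
    using orthogonal_projection_matrix_exists[OF \<open>subspace R\<close>] by metis
  obtain Q where Q: "transpose Q = Q" "\<And>y. Q *v y \<in> range ((*v) A)"
    "\<And>y. y \<in> range ((*v) A) \<Longrightarrow> Q *v y = y"
    using orthogonal_projection_matrix_exists[OF \<open>subspace (range ((*v) A))\<close>] by metis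
  have QA: "Q *v (A *v x) = A *v x" for x
    by (rule Q(3)) (rule rangeI)
  have AP: "A *v (P *v x) = A *v x" for x
  proof -
    have "A *v (x - P *v x) = 0"
      using P(4) unfolding kernel_orthogonal_range_transpose R_def[symmetric] by blast
    then show ?thesis by (simp add: matrix_vector_mult_diff_distrib)
  qed
  have span_R: "span R = R"
    using \<open>subspace R\<close> by (rule span_eq_iff[THEN iffD2])
  have "inj_on ((*v) A) R"
  proof (rule inj_onI)
    fix x y assume "x \<in> R" "y \<in> R" and Axy: "A *v x = A *v y"
    then have "x - y \<in> R"
      using \<open>subspace R\<close> by (simp add: subspace_diff)
    moreover have "A *v (x - y) = 0"
      using Axy by (simp add: matrix_vector_mult_diff_distrib)
    ultimately have "(x - y) \<bullet> (x - y) = 0"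
      unfolding kernel_orthogonal_range_transpose R_def[symmetric] by blast
    then show "x = y" by simp
  qed
  then obtain g where g: "range g \<subseteq> R" "linear g" "\<And>x. x \<in> R \<Longrightarrow> g (A *v x) = x"
    using linear_inj_on_left_inverse[OF matrix_vector_mul_linear[of A], of R] unfolding span_R by blast
  have gAP: "g (A *v x) = P *v x" for x
    using g(3)[OF P(2), of x] by (simp add: AP)
  \<comment> \<open>\<open>Y\<close> inverts \<open>A\<close> on its row space after projecting onto its column space,
    so that \<open>Y A = P\<close> and \<open>A Y = Q\<close>.\<close>
  define Y where "Y = matrix (g \<circ> (*v) Q)"
  have Yv: "Y *v y = g (Q *v y)" for y
    unfolding Y_def
    by (simp add: linear_compose[OF matrix_vector_mul_linear g(2)] matrix_vector_mul[symmetric])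
  have YA: "Y ** A = P"
    unfolding matrix_eq by (simp add: matrix_vector_mul_assoc[symmetric] Yv QA gAP)
  have AY: "A ** Y = Q"
  proof (unfold matrix_eq, intro allI)
    fix y
    obtain x where x: "Q *v y = A *v x" using Q(2) by blast
    show "A ** Y *v y = Q *v y"
      by (simp add: matrix_vector_mul_assoc[symmetric] Yv x gAP AP)
  qed
  have "P ** Y = Y"
    unfolding matrix_eq using g(1) by (simp add: matrix_vector_mul_assoc[symmetric] Yv P(3) subset_iff)
  then have "Y ** A ** Y = Y" by (simp add: YA)
  moreover have "Q ** A = A"
    unfolding matrix_eq by (simp add: matrix_vector_mul_assoc[symmetric] QA)
  ultimately show thesis
    by (intro that[of Y]) (simp add: moore_penrose_def P(1) Q(1) AY YA)
qed

lemma moore_penrose_unique: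
  assumes "moore_penrose A Y" "moore_penrose A Z"
  shows "Y = Z"
proof -
  have y1: "A ** Y ** A = A" and y2: "Y ** A ** Y = Y" and y3: "transpose (A ** Y) = A ** Y"
    and y4: "transpose (Y ** A) = Y ** A"
    using assms(1) unfolding moore_penrose_def by auto
  have z1: "A ** Z ** A = A" and z2: "Z ** A ** Z = Z" and z3: "transpose (A ** Z) = A ** Z"
    and z4: "transpose (Z ** A) = Z ** A"
    using assms(2) unfolding moore_penrose_def by auto
  have "Y = Y ** transpose (A ** Y)" using y2 y3 by (metis matrix_mul_assoc)
  also have "\<dots> = Y ** transpose (A ** Z ** A ** Y)" using z1 by simp
  also have "\<dots> = Y ** transpose (A ** Y) ** transpose (A ** Z)"
    by (simp add: matrix_transpose_mul matrix_mul_assoc)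
  also have "\<dots> = Y ** A ** Y ** A ** Z" by (simp add: y3 z3 matrix_mul_assoc)
  finally have Y: "Y = Y ** A ** Z" using y2 by simp
  have "Z = transpose (Z ** A) ** Z" using z2 z4 by simp
  also have "\<dots> = transpose (Z ** (A ** Y ** A)) ** Z" using y1 by simp
  also have "\<dots> = transpose (Y ** A) ** transpose (Z ** A) ** Z"
    by (simp add: matrix_transpose_mul matrix_mul_assoc)
  also have "\<dots> = Y ** A ** Z ** A ** Z" by (simp add: y4 z4 matrix_mul_assoc)
  finally show ?thesis using Y z2 by (simp add: matrix_mul_assoc)
qed

lemma impinv_conditions_iff_moore_penrose:
  fixes M :: "real^'m^'m" and N :: "real^'n^'n" and A :: "real^'n^'m" and Y :: "real^'m^'n"
  assumes "weight M" "weight N"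
  shows "(imult M (imult N A (N ** Y ** M)) A = A \<and>
      imult N (imult M (N ** Y ** M) A) (N ** Y ** M) = N ** Y ** M \<and>
      iadj M M (imult N A (N ** Y ** M)) = imult N A (N ** Y ** M) \<and>
      iadj N N (imult M (N ** Y ** M) A) = imult M (N ** Y ** M) A) \<longleftrightarrow> moore_penrose A Y"
proof -
  have "transpose M = M" "transpose N = N" "M ** M = mat 1"
    using assms unfolding weight_def by auto
  then show ?thesis
    unfolding imult_def iadj_def moore_penrose_def
    by (simp add: matrix_transpose_mul matrix_mul_assoc weight_mult_cancel[OF assms(1)]
        weight_mult_cancel[OF assms(2)] weight_mult_inj[OF assms(1)] weight_mult_inj[OF assms(2)],
        simp add: matrix_mul_assoc[symmetric] weight_mult_inj[OF assms(2)])
qed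

lemma impinv_eq:
  assumes "weight M" "weight N" "moore_penrose A Y"
  shows "impinv M N A = N ** Y ** M"
  unfolding impinv_def
proof (rule the_equality)
  fix X
  have X: "X = N ** (N ** X ** M) ** M"
    using assms(2) unfolding weight_def
    by (simp add: matrix_mul_assoc weight_mult_cancel(2)[OF assms(1)])
  assume "imult M (imult N A X) A = A \<and> imult N (imult M X A) X = X \<and>
    iadj M M (imult N A X) = imult N A X \<and> iadj N N (imult M X A) = imult M X A"
  then have "moore_penrose A (N ** X ** M)"
    using impinv_conditions_iff_moore_penrose[OF assms(1,2), of A "N ** X ** M"]
    unfolding X[symmetric] by blast
  then have "N ** X ** M = Y"
    using assms(3) by (rule moore_penrose_unique)
  then show "X = N ** Y ** M" using X by simp
qed (use impinv_conditions_iff_moore_penrose[OF assms(1,2)] assms(3) in blast)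

lemma convex_icone: "icone C \<Longrightarrow> convex C"
  unfolding icone_def convex_def by auto

lemma icone_linear_image:
  assumes "icone K" "linear f"
  shows "icone (f ` K)"
  using assms unfolding icone_def
  by (auto simp: linear_add[OF assms(2), symmetric] linear_scale[OF assms(2), symmetric])

text \<open>Linear images of closed cones need not be closed; an inner inverse \<open>g\<close> of \<open>f\<close> mapping
  \<open>f ` K\<close> back into \<open>K\<close> exhibits \<open>f ` K\<close> as \<open>range f \<inter> g -` K\<close>.\<close>

lemma closed_linear_image_inner_inverse:
  fixes f :: "'a::euclidean_space \<Rightarrow> 'b::euclidean_space" and g :: "'b \<Rightarrow> 'a"
  assumes "linear f" "linear g" "\<And>x. f (g (f x)) = f x" "\<And>x. x \<in> K \<Longrightarrow> g (f x) \<in> K"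
    and "closed K"
  shows "closed (f ` K)"
proof -
  have "f ` K = range f \<inter> g -` K"
  proof
    show "range f \<inter> g -` K \<subseteq> f ` K"
    proof
      fix y assume "y \<in> range f \<inter> g -` K"
      then obtain x where "y = f x" "g y \<in> K" by auto
      then show "y \<in> f ` K" using assms(3) by (metis image_eqI)
    qed
  qed (use assms(4) in auto)
  moreover have "closed (range f)"
    by (intro closed_subspace linear_subspace_image assms(1) subspace_UNIV)
  moreover have "closed (g -` K)"
    using assms(2,5) linear_conv_bounded_linear by (blast intro: closed_vimage linear_continuous_on)
  ultimately show ?thesis by auto
qed

lemma closed_cone_separation_in_subspace:
  fixes C S :: "'a::euclidean_space set"
  assumes "icone C" "closed C" "subspace S" "C \<subseteq> S" "y \<in> S" "y \<notin> C"
  obtains w where "w \<in> S" "\<And>z. z \<in> C \<Longrightarrow> 0 \<le> w \<bullet> z" "w \<bullet> y < 0"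
proof -
  have cone: "C \<noteq> {}" "\<And>x z. x \<in> C \<Longrightarrow> z \<in> C \<Longrightarrow> x + z \<in> C"
    "\<And>x t. x \<in> C \<Longrightarrow> 0 \<le> t \<Longrightarrow> t *\<^sub>R x \<in> C"
    using assms(1) unfolding icone_def by auto
  define c where "c = closest_point C y"
  have c: "c \<in> C"
    unfolding c_def using assms(2) cone(1) by (rule closest_point_in_set)
  have obtuse: "(y - c) \<bullet> (z - c) \<le> 0" if "z \<in> C" for z
    unfolding c_def using convex_icone[OF assms(1)] assms(2) that by (rule closest_point_dot)
  have "(y - c) \<bullet> (0 - c) \<le> 0"
    by (rule obtuse) (use cone(3)[OF c, of 0] in simp)
  moreover have "(y - c) \<bullet> (2 *\<^sub>R c - c) \<le> 0"
    by (rule obtuse) (use cone(3)[OF c, of 2] in simp)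
  ultimately have orth: "(y - c) \<bullet> c = 0"
    by (simp add: inner_diff_right)
  show thesis
  proof (rule that[of "c - y"])
    show "c - y \<in> S"
      using assms(3-5) c by (auto intro: subspace_diff)
    show "0 \<le> (c - y) \<bullet> z" if "z \<in> C" for z
      using obtuse[OF cone(2)[OF that c]] by (simp add: inner_diff_left inner_diff_right)
    have "(c - y) \<bullet> y = - ((c - y) \<bullet> (c - y))"
      using orth by (simp add: inner_diff_left inner_diff_right inner_commute)
    moreover have "c \<noteq> y" using c assms(6) by auto
    ultimately show "(c - y) \<bullet> y < 0" by simp
  qed
qed

lemma acute_dual_inter_subspace_iff:
  fixes M :: "real^'m^'m"
  assumes "weight M" "icone C" "closed C" "subspace S" "C \<subseteq> S"
    and "\<And>x. x \<in> S \<Longrightarrow> M *v x \<in> S"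
  shows "acute M (idual M C \<inter> S) \<longleftrightarrow> idual M C \<inter> S \<subseteq> C"
proof
  assume acute: "acute M (idual M C \<inter> S)"
  show "idual M C \<inter> S \<subseteq> C"
  proof (rule subsetI, rule ccontr)
    fix y assume y: "y \<in> idual M C \<inter> S" "y \<notin> C"
    then obtain w where w: "w \<in> S" "\<And>z. z \<in> C \<Longrightarrow> 0 \<le> w \<bullet> z" "w \<bullet> y < 0"
      using closed_cone_separation_in_subspace[OF assms(2-5)] by blast
    have "M *v w \<in> idual M C \<inter> S"
      using w assms(6) by (simp add: idual_def iinner_weight_left[OF assms(1)])
    then have "0 \<le> iinner M y (M *v w)"
      using acute y(1) unfolding acute_def by blast
    with w(3) show False
      by (simp add: iinner_weight_right[OF assms(1)] inner_commute)
  qed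
next
  assume "idual M C \<inter> S \<subseteq> C"
  then show "acute M (idual M C \<inter> S)"
    unfolding acute_def idual_def by blast
qed

lemma impinv_inner_inverse:
  assumes "weight M" "weight N" "M ** A = A ** N"
  shows "A ** impinv M N A ** A = A"
proof -
  obtain Y where Y: "moore_penrose A Y" by (rule moore_penrose_exists)
  have "A ** impinv M N A ** A = (A ** N) ** Y ** (M ** A)"
    by (simp add: impinv_eq[OF assms(1,2) Y] matrix_mul_assoc)
  also have "\<dots> = M ** (A ** Y ** A) ** N"
    by (simp add: assms(3) matrix_mul_assoc)
  also have "\<dots> = M ** (A ** N)"
    using Y by (simp add: moore_penrose_def matrix_mul_assoc)
  also have "\<dots> = A"
    by (simp add: assms(3)[symmetric] weight_mult_cancel(1)[OF assms(1)])
  finally show ?thesis .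
qed

lemma imultv_imult_intertwining:
  assumes "weight M" "M ** A = A ** N"
  shows "imultv N (imult M X A) x = X *v (A *v x)"
  by (simp add: imultv_def imult_def matrix_vector_mul_assoc matrix_mul_assoc[symmetric]
      assms(2)[symmetric] weight_mult_cancel(1)[OF assms(1)])

lemma range_invariant_intertwining:
  assumes "M ** A = A ** N" "x \<in> range ((*v) A)"
  shows "M *v x \<in> range ((*v) A)"
proof -
  obtain v where "x = A *v v" using assms(2) by blast
  then have "M *v x = A *v (N *v v)" by (simp add: matrix_vector_mul_assoc assms(1))
  then show ?thesis by simp
qed

theorem lemma3p10:
  fixes M :: "real^'m^'m" and N :: "real^'n^'n" and A :: "real^'n^'m"
    and K :: "(real^'n) set"
  assumes "weight M" and "weight N" and "M ** A = A ** N"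
    and "icone K" and "closed K"
    and "imultset N (imult M (impinv M N A) A) K \<subseteq> K"
  shows "acute M (idual M (imultset N (imult N A (mat 1)) K) \<inter> irange N (imult N A (mat 1)))
     \<longleftrightarrow> idual M (imultset N (imult N A (mat 1)) K) \<inter> irange N (imult N A (mat 1))
          \<subseteq> imultset N (imult N A (mat 1)) K"
proof -
  have "closed ((*v) A ` K)"
  proof (rule closed_linear_image_inner_inverse
      [OF matrix_vector_mul_linear matrix_vector_mul_linear _ _ assms(5)])
    show "A *v (impinv M N A *v (A *v x)) = A *v x" for x
      by (simp add: matrix_vector_mul_assoc matrix_mul_assoc impinv_inner_inverse[OF assms(1-3)])
    show "impinv M N A *v (A *v x) \<in> K" if "x \<in> K" for x
      using assms(6) that by (auto simp: imultset_def imultv_imult_intertwining[OF assms(1,3)])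
  qed
  moreover have "imultset N (imult N A (mat 1)) K = (*v) A ` K"
    by (simp add: imultset_def imultv_weighted_identity[OF assms(2)] image_def)
  moreover have "irange N (imult N A (mat 1)) = range ((*v) A)"
    by (auto simp: irange_def imultv_weighted_identity[OF assms(2)])
  ultimately show ?thesis
    using range_invariant_intertwining[OF assms(3)]
    by (simp add: acute_dual_inter_subspace_iff assms(1,4) icone_linear_image
        matrix_vector_mul_linear linear_subspace_image image_mono)
qed

end
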